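(* Consider one time step $(t_n,t_{n+1})$, $\Delta t_n=t_{n+1}-t_n$, of the fully discrete scheme for incompressible elastodynamics described in the context: given $\{\boldsymbol U_n,P_n,\boldsymbol V_n\}$, the state $\{\boldsymbol U_{n+1},P_{n+1},\boldsymbol V_{n+1}\}$ in the trial spaces satisfies the three discrete equations (i)-(iii) of the context for all test functions $\{\boldsymbol W,Q\}\in\mathcal V_{\boldsymbol V}\times\mathcal V_P$. Assume that the boundary data $\boldsymbol G$ is time independent and that the directionality property $$\boldsymbol S_{\mathrm{alg}}:\boldsymbol Z_n = G_{\mathrm{ich}}(\tilde{\boldsymbol C}_{n+1})-G_{\mathrm{ich}}(\tilde{\boldsymbol C}_n),\qquad \boldsymbol Z_n:=\tfrac12(\boldsymbol C_{n+1}-\boldsymbol C_n),$$ holds for the algorithmic stress $\boldsymbol S_{\mathrm{alg}}$. Then the scheme enjoys the energy stability property $$\frac{1}{\Delta t_n}\left(H_{n+1}-H_n\right)=\int_{\Omega_{\boldsymbol X}}\rho_0\boldsymbol V_m\cdot\boldsymbol B_m\,d\Omega_{\boldsymbol X}+\int_{\Gamma^H_{\boldsymbol X}}\boldsymbol V_m\cdot\boldsymbol H_m\,d\Gamma_{\boldsymbol X}-\mathcal D_m,$$ where $$H_k:=\int_{\Omega_{\boldsymbol X}}\tfrac12\rho_0\|\boldsymbol V_k\|^2+G_{\mathrm{ich}}(\tilde{\boldsymbol C}_k)\,d\Omega_{\boldsymbol X}\quad(k=n,n+1),\qquad \mathcal D_m:=\int_{\Omega_{\boldsymbol X}}\gamma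 J_m\left(\nabla_{\boldsymbol X}\boldsymbol V_m:\boldsymbol F_m^{-\mathrm T}\right)^2d\Omega_{\boldsymbol X}\ \ge 0 .$$
   Context: Domain and data. $\Omega_{\boldsymbol X}\subset\mathbb R^3$ is a bounded open set (initial configuration of the body) with Lipschitz boundary $\Gamma_{\boldsymbol X}=\Gamma^G_{\boldsymbol X}\cup\Gamma^H_{\boldsymbol X}$ (non-overlapping Dirichlet and Neumann parts). $\rho_0$ is the density, $\gamma\ge0$ a constant (grad-div stabilization parameter), $\boldsymbol B(\boldsymbol X,t)$ the body force per unit mass, $\boldsymbol H(\boldsymbol X,t)$ the traction prescribed on $\Gamma^H_{\boldsymbol X}$, $\boldsymbol G(\boldsymbol X,t)$ the displacement prescribed on $\Gamma^G_{\boldsymbol X}$. $G_{\mathrm{ich}}$ is the isochoric free energy, a real-valued function of the modified right Cauchy-Green tensor $\tilde{\boldsymbol C}$. Conventions: $(\nabla_{\boldsymbol X}\boldsymbol W)_{iI}=\partial W_i/\partial X_I$, $\boldsymbol A:\boldsymbol B=\sum_{i,j} A_{ij}B_{ij}$. Discrete spaces. Let $\hat\Omega=(0,1)^3$. $\mathcal R^{q_1,q_2,q_3}_{\boldsymbol\alpha_1,\boldsymbol\alpha_2,\boldsymbol\alpha_3}$ denotes the space of multivariate NURBS functions on $\hat\Omega$ built from open knot vectors and a given set of weights, with degree $q_d$ and inter-element regularity $\boldsymbol\alpha_d$ in the $d$-th parametric direction. With integers $\mathsf a\ge1$, $0\le\mathsf b<\mathsf a$, let $\hat{\mathcal S}_h=\big(\mathcal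 R^{\mathsf p+\mathsf a,\mathsf p+\mathsf a,\mathsf p+\mathsf a}_{\boldsymbol r_1+\mathsf b,\boldsymbol r_2+\mathsf b,\boldsymbol r_3+\mathsf b}\big)^3$ and $\hat{\mathcal P}_h=\mathcal R^{\mathsf p,\mathsf p,\mathsf p}_{\boldsymbol r_1,\boldsymbol r_2,\boldsymbol r_3}$. Let $\boldsymbol\psi:\hat\Omega\to\Omega_{\boldsymbol X}$ be a smooth invertible geometrical map, and set $\mathcal S_h=\{\boldsymbol W:\boldsymbol W\circ\boldsymbol\psi\in\hat{\mathcal S}_h\}$, $\mathcal P_h=\{Q:Q\circ\boldsymbol\psi\in\hat{\mathcal P}_h\}$. Trial spaces at time $t$: displacements $\boldsymbol U\in\mathcal S_h$ with $\boldsymbol U=\boldsymbol G(\cdot,t)$ on $\Gamma^G_{\boldsymbol X}$; pressures $P\in\mathcal P_h$; velocities $\boldsymbol V\in\mathcal S_h$ with $\boldsymbol V=\frac{d\boldsymbol G}{dt}(\cdot,t)$ on $\Gamma^G_{\boldsymbol X}$. Test spaces: $\mathcal V_{\boldsymbol V}=\{\boldsymbol W\in\mathcal S_h:\boldsymbol W=\boldsymbol 0\text{ on }\Gamma^G_{\boldsymbol X}\}$ and $\mathcal V_P=\mathcal P_h$. Kinematic quantities. For $k\in\{n,n+1\}$: $\boldsymbol F_k=\nabla_{\boldsymbol X}\boldsymbol U_k+\boldsymbol I$, $\boldsymbol C_k=\boldsymbol F_k^{\mathrm T}\boldsymbol F_k$, $J_k=\det\boldsymbol F_k$, $\tilde{\boldsymbol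 C}_k=J_k^{-2/3}\boldsymbol C_k$. Mid-point quantities: $\boldsymbol U_m=\frac12(\boldsymbol U_n+\boldsymbol U_{n+1})$, $P_m=\frac12(P_n+P_{n+1})$, $\boldsymbol V_m=\frac12(\boldsymbol V_n+\boldsymbol V_{n+1})$, $\boldsymbol F_m=\nabla_{\boldsymbol X}\boldsymbol U_m+\boldsymbol I$, $J_m=\det\boldsymbol F_m$, $\boldsymbol C_m=\frac12(\boldsymbol C_n+\boldsymbol C_{n+1})$, $\tilde{\boldsymbol C}_m=J_m^{-2/3}\boldsymbol C_m$; $\boldsymbol B_m=\boldsymbol B(\cdot,t_m)$, $\boldsymbol H_m=\boldsymbol H(\cdot,t_m)$ with $t_m=\frac12(t_n+t_{n+1})$. Algorithmic stress. The isochoric second Piola-Kirchhoff stress is $\boldsymbol S_{\mathrm{ich}}=J^{-2/3}\,\mathbb P:\big(2\,\partial G_{\mathrm{ich}}/\partial\tilde{\boldsymbol C}\big)$ with $\mathbb P=\mathbb I-\frac13\boldsymbol C^{-1}\otimes\boldsymbol C$ and $\mathbb I$ the fourth-order identity tensor. The algorithmic stress is $\boldsymbol S_{\mathrm{alg}}:=\boldsymbol S_{\mathrm{ich}}(\boldsymbol C_m)+\boldsymbol S_{\mathrm{enh}}$, where the tensor field $\boldsymbol S_{\mathrm{enh}}$ (the "stress enhancement") is left unspecified here. Scheme. The discrete equations are, for all $\boldsymbol W\in\mathcal V_{\boldsymbol V}$, $Q\in\mathcal V_P$: (i) $\displaystyle \boldsymbol 0=\frac{\boldsymbol U_{n+1}-\boldsymbol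 U_n}{\Delta t_n}-\boldsymbol V_m$; (ii) $\displaystyle 0=\int_{\Omega_{\boldsymbol X}}Q\,J_m\nabla_{\boldsymbol X}\boldsymbol V_m:\boldsymbol F_m^{-\mathrm T}\,d\Omega_{\boldsymbol X}$; (iii) $\displaystyle 0=\int_{\Omega_{\boldsymbol X}}\Big[\boldsymbol W\cdot\rho_0\frac{\boldsymbol V_{n+1}-\boldsymbol V_n}{\Delta t_n}+(\boldsymbol F_m^{\mathrm T}\nabla_{\boldsymbol X}\boldsymbol W):\boldsymbol S_{\mathrm{alg}}-J_mP_m\nabla_{\boldsymbol X}\boldsymbol W:\boldsymbol F_m^{-\mathrm T}-\boldsymbol W\cdot\rho_0\boldsymbol B_m\Big]d\Omega_{\boldsymbol X}-\int_{\Gamma^H_{\boldsymbol X}}\boldsymbol W\cdot\boldsymbol H_m\,d\Gamma_{\boldsymbol X}+\int_{\Omega_{\boldsymbol X}}\gamma J_m\big(\nabla_{\boldsymbol X}\boldsymbol W:\boldsymbol F_m^{-\mathrm T}\big)\big(\nabla_{\boldsymbol X}\boldsymbol V_m:\boldsymbol F_m^{-\mathrm T}\big)d\Omega_{\boldsymbol X}.$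
   Formalization: The stress enhancement S_enh is assumed symmetric (false otherwise: its skew part does work); J_n, J_{n+1}, J_m are positive a.e.; G_ich is differentiable; the integrals in (ii), (iii) and H_k exist; and ψ extends to a continuous bijection of the closed cube onto the closure of Ω_X. *)

theory Defs
  imports "HOL-Analysis.Analysis"
begin

section \<open>Domains and surface integration\<close>

type_synonym vec3 = "real^3"
type_synonym tensor2 = "real^3^3"
type_synonym tensor4 = "real^3^3^3^3"

text \<open>
  Near each boundary point the domain is the strict epigraph, in some direction \<open>e\<close>, of a
  Lipschitz function of the coordinates orthogonal to \<open>e\<close>.
\<close>

definition lipschitz_boundary :: "vec3 set \<Rightarrow> bool" where
  "lipschitz_boundary \<Omega> \<longleftrightarrow>
    (\<forall>x\<in>frontier \<Omega>. \<exists>r>0. \<exists>e L. \<exists>\<phi>::vec3 \<Rightarrow> real. norm e = 1 \<and> L-lipschitz_on UNIV \<phi> \<and>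
       (\<forall>y\<in>ball x r. y \<in> \<Omega> \<longleftrightarrow> \<phi> (y - (y \<bullet> e) *\<^sub>R e) < y \<bullet> e))"

text \<open>
  The surface measure is the two-dimensional Hausdorff measure, restricted to its Caratheodory
  measurable sets.  The factor \<open>pi / 4\<close> makes it agree with area on planar sets.
\<close>

definition hausdorff2_outer :: "vec3 set \<Rightarrow> ennreal" where
  "hausdorff2_outer A =
    (SUP \<delta>\<in>{0<..}.
      INF C\<in>{C::nat \<Rightarrow> vec3 set. A \<subseteq> (\<Union>i. C i) \<and> (\<forall>i. bounded (C i) \<and> diameter (C i) \<le> \<delta>)}.
        \<Sum>i. ennreal (pi / 4 * (diameter (C i))\<^sup>2))"

definition surface_measure :: "vec3 measure" where
  "surface_measure =
    measure_of UNIV (lambda_system UNIV (Pow UNIV) hausdorff2_outer) hausdorff2_outer"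

text \<open>\<open>C_k_on k S f\<close>: on the open set \<open>S\<close>, the map \<open>f\<close> is \<open>k\<close> times continuously differentiable.\<close>

primrec C_k_on :: "nat \<Rightarrow> vec3 set \<Rightarrow> (vec3 \<Rightarrow> vec3) \<Rightarrow> bool" where
  "C_k_on 0 S f \<longleftrightarrow> continuous_on S f"
| "C_k_on (Suc k) S f \<longleftrightarrow> (\<forall>x\<in>S. f differentiable (at x)) \<and>
     (\<forall>v. C_k_on k S (\<lambda>x. frechet_derivative f (at x) v))"

definition smooth_on :: "vec3 set \<Rightarrow> (vec3 \<Rightarrow> vec3) \<Rightarrow> bool" where
  "smooth_on S f \<longleftrightarrow> (\<forall>k. C_k_on k S f)"

text \<open>
  The map is taken up to the boundary of the parametric cube, since boundary values of the
  discrete functions are needed; smoothness is required in the open cube only.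
\<close>

definition geometrical_map :: "vec3 set \<Rightarrow> (vec3 \<Rightarrow> vec3) \<Rightarrow> bool" where
  "geometrical_map \<Omega> \<psi> \<longleftrightarrow>
    smooth_on (box 0 1) \<psi> \<and> bij_betw \<psi> (box 0 1) \<Omega> \<and>
    continuous_on (cbox 0 1) \<psi> \<and> bij_betw \<psi> (cbox 0 1) (closure \<Omega>)"


section \<open>NURBS spaces\<close>

text \<open>
  In each parametric direction the mesh is given by the interior breakpoints \<open>Z\<close> and the
  regularities \<open>\<alpha>\<close> at these breakpoints, where \<open>-1\<close> stands for a jump.  For degree \<open>q\<close>, a
  breakpoint of regularity \<open>a\<close> is a knot of multiplicity \<open>q - a\<close>; the knot vector is open, so the
  end points have multiplicity \<open>q + 1\<close>.
\<close>

definition valid_mesh :: "nat \<Rightarrow> real list \<Rightarrow> int list \<Rightarrow> bool" where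
  "valid_mesh q Z \<alpha> \<longleftrightarrow>
    sorted_wrt (<) Z \<and> set Z \<subseteq> {0<..<1} \<and> length \<alpha> = length Z \<and>
    (\<forall>a\<in>set \<alpha>. -1 \<le> a \<and> a < int q)"

definition knot_vector :: "nat \<Rightarrow> real list \<Rightarrow> int list \<Rightarrow> real list" where
  "knot_vector q Z \<alpha> =
    replicate (q + 1) 0 @
    concat (map2 (\<lambda>z a. replicate (nat (int q - a)) z) Z \<alpha>) @
    replicate (q + 1) 1"

text \<open>
  Cox--de Boor recursion, with knots numbered from 0.  The convention \<open>0 / 0 = 0\<close> is that of
  division in HOL.  The last nonempty knot span is closed on the right, so that the
  B-splines are left-continuous at the end point of the parametric interval.
\<close>

fun bspline :: "real list \<Rightarrow> nat \<Rightarrow> nat \<Rightarrow> real \<Rightarrow> real" where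
  "bspline \<Xi> i 0 x =
    (if \<Xi> ! i \<le> x \<and> x < \<Xi> ! (i + 1) \<or> \<Xi> ! i < x \<and> x = \<Xi> ! (i + 1) \<and> x = last \<Xi>
     then 1 else 0)"
| "bspline \<Xi> i (Suc q) x =
    (x - \<Xi> ! i) / (\<Xi> ! (i + q + 1) - \<Xi> ! i) * bspline \<Xi> i q x +
    (\<Xi> ! (i + q + 2) - x) / (\<Xi> ! (i + q + 2) - \<Xi> ! (i + 1)) * bspline \<Xi> (i + 1) q x"

definition basis_indices :: "(3 \<Rightarrow> nat) \<Rightarrow> (3 \<Rightarrow> real list) \<Rightarrow> (3 \<Rightarrow> int list) \<Rightarrow> (3 \<Rightarrow> nat) set" where
  "basis_indices q Z \<alpha> = {i. \<forall>d. i d < length (knot_vector (q d) (Z d) (\<alpha> d)) - q d - 1}"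

definition tensor_bspline ::
  "(3 \<Rightarrow> nat) \<Rightarrow> (3 \<Rightarrow> real list) \<Rightarrow> (3 \<Rightarrow> int list) \<Rightarrow> (3 \<Rightarrow> nat) \<Rightarrow> vec3 \<Rightarrow> real" where
  "tensor_bspline q Z \<alpha> i \<xi> =
    (\<Prod>d\<in>UNIV. bspline (knot_vector (q d) (Z d) (\<alpha> d)) (i d) (q d) (\<xi> $ d))"

definition nurbs_basis ::
  "(3 \<Rightarrow> nat) \<Rightarrow> (3 \<Rightarrow> real list) \<Rightarrow> (3 \<Rightarrow> int list) \<Rightarrow> ((3 \<Rightarrow> nat) \<Rightarrow> real) \<Rightarrow>
   (3 \<Rightarrow> nat) \<Rightarrow> vec3 \<Rightarrow> real" where
  "nurbs_basis q Z \<alpha> w i \<xi> =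
    w i * tensor_bspline q Z \<alpha> i \<xi> /
    (\<Sum>j\<in>basis_indices q Z \<alpha>. w j * tensor_bspline q Z \<alpha> j \<xi>)"

definition nurbs_space ::
  "(3 \<Rightarrow> nat) \<Rightarrow> (3 \<Rightarrow> real list) \<Rightarrow> (3 \<Rightarrow> int list) \<Rightarrow> ((3 \<Rightarrow> nat) \<Rightarrow> real) \<Rightarrow>
   (vec3 \<Rightarrow> real) set" where
  "nurbs_space q Z \<alpha> w =
    {f. \<exists>c. f = (\<lambda>\<xi>. \<Sum>i\<in>basis_indices q Z \<alpha>. c i * nurbs_basis q Z \<alpha> w i \<xi>)}"

definition positive_weights ::
  "(3 \<Rightarrow> nat) \<Rightarrow> (3 \<Rightarrow> real list) \<Rightarrow> (3 \<Rightarrow> int list) \<Rightarrow> ((3 \<Rightarrow> nat) \<Rightarrow> real) \<Rightarrow> bool" where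
  "positive_weights q Z \<alpha> w \<longleftrightarrow> (\<forall>i\<in>basis_indices q Z \<alpha>. 0 < w i)"


section \<open>Discrete spaces on the physical domain\<close>

definition raise_regularity :: "nat \<Rightarrow> (3 \<Rightarrow> int list) \<Rightarrow> 3 \<Rightarrow> int list" where
  "raise_regularity b r d = map (\<lambda>k. k + int b) (r d)"

definition S_hat ::
  "nat \<Rightarrow> nat \<Rightarrow> nat \<Rightarrow> (3 \<Rightarrow> real list) \<Rightarrow> (3 \<Rightarrow> int list) \<Rightarrow> ((3 \<Rightarrow> nat) \<Rightarrow> real) \<Rightarrow>
   (vec3 \<Rightarrow> vec3) set" where
  "S_hat p a b Z r w =
    {f. \<forall>i. (\<lambda>\<xi>. f \<xi> $ i) \<in> nurbs_space (\<lambda>_. p + a) Z (raise_regularity b r) w}"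

definition P_hat ::
  "nat \<Rightarrow> (3 \<Rightarrow> real list) \<Rightarrow> (3 \<Rightarrow> int list) \<Rightarrow> ((3 \<Rightarrow> nat) \<Rightarrow> real) \<Rightarrow> (vec3 \<Rightarrow> real) set" where
  "P_hat p Z r w = nurbs_space (\<lambda>_. p) Z r w"

text \<open>
  Functions are total in HOL; only their values on \<open>\<psi> ` cbox 0 1\<close>, the closure of the
  physical domain, are constrained.
\<close>

definition push_forward :: "(vec3 \<Rightarrow> vec3) \<Rightarrow> (vec3 \<Rightarrow> 'b) set \<Rightarrow> (vec3 \<Rightarrow> 'b) set" where
  "push_forward \<psi> R = {W. \<exists>f\<in>R. \<forall>\<xi>\<in>cbox 0 1. W (\<psi> \<xi>) = f \<xi>}"

definition trial_displacements ::
  "(vec3 \<Rightarrow> vec3) set \<Rightarrow> vec3 set \<Rightarrow> (vec3 \<Rightarrow> real \<Rightarrow> vec3) \<Rightarrow> real \<Rightarrow> (vec3 \<Rightarrow> vec3) set" where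
  "trial_displacements S \<Gamma>G G t = {U \<in> S. \<forall>X\<in>\<Gamma>G. U X = G X t}"

definition trial_velocities ::
  "(vec3 \<Rightarrow> vec3) set \<Rightarrow> vec3 set \<Rightarrow> (vec3 \<Rightarrow> real \<Rightarrow> vec3) \<Rightarrow> real \<Rightarrow> (vec3 \<Rightarrow> vec3) set" where
  "trial_velocities S \<Gamma>G G t = {V \<in> S. \<forall>X\<in>\<Gamma>G. V X = vector_derivative (G X) (at t)}"

definition test_velocities :: "(vec3 \<Rightarrow> vec3) set \<Rightarrow> vec3 set \<Rightarrow> (vec3 \<Rightarrow> vec3) set" where
  "test_velocities S \<Gamma>G = {W \<in> S. \<forall>X\<in>\<Gamma>G. W X = 0}"


section \<open>Kinematics\<close>

text \<open>
  The double contraction of second-order tensors is the inner product \<open>\<bullet>\<close> on \<open>real^3^3\<close>, and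
  \<open>jacobian W (at X) $ i $ j\<close> is the derivative of the \<open>i\<close>-th component of \<open>W\<close> in the \<open>j\<close>-th direction.
\<close>

abbreviation grad :: "(vec3 \<Rightarrow> vec3) \<Rightarrow> vec3 \<Rightarrow> tensor2" where
  "grad W X \<equiv> jacobian W (at X)"

definition midpoint_field :: "(vec3 \<Rightarrow> 'b::real_vector) \<Rightarrow> (vec3 \<Rightarrow> 'b) \<Rightarrow> vec3 \<Rightarrow> 'b" where
  "midpoint_field f g X = (1/2) *\<^sub>R (f X + g X)"

definition def_grad :: "(vec3 \<Rightarrow> vec3) \<Rightarrow> vec3 \<Rightarrow> tensor2" where
  "def_grad U X = grad U X + mat 1"

definition inv_transpose :: "tensor2 \<Rightarrow> tensor2" where
  "inv_transpose A = transpose (matrix_inv A)"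

definition cauchy_green :: "(vec3 \<Rightarrow> vec3) \<Rightarrow> vec3 \<Rightarrow> tensor2" where
  "cauchy_green U X = transpose (def_grad U X) ** def_grad U X"

definition jac :: "(vec3 \<Rightarrow> vec3) \<Rightarrow> vec3 \<Rightarrow> real" where
  "jac U X = det (def_grad U X)"

definition modified_cauchy_green :: "(vec3 \<Rightarrow> vec3) \<Rightarrow> vec3 \<Rightarrow> tensor2" where
  "modified_cauchy_green U X = jac U X powr (-2/3) *\<^sub>R cauchy_green U X"

text \<open>
  The mid-point right Cauchy--Green tensor is the average of the end-point tensors, not the
  tensor of the mid-point displacement.
\<close>

definition cauchy_green_mid :: "(vec3 \<Rightarrow> vec3) \<Rightarrow> (vec3 \<Rightarrow> vec3) \<Rightarrow> vec3 \<Rightarrow> tensor2" where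
  "cauchy_green_mid U0 U1 X = (1/2) *\<^sub>R (cauchy_green U0 X + cauchy_green U1 X)"

definition cauchy_green_increment :: "(vec3 \<Rightarrow> vec3) \<Rightarrow> (vec3 \<Rightarrow> vec3) \<Rightarrow> vec3 \<Rightarrow> tensor2" where
  "cauchy_green_increment U0 U1 X = (1/2) *\<^sub>R (cauchy_green U1 X - cauchy_green U0 X)"


section \<open>Stresses\<close>

definition symmetric_tensors :: "tensor2 set" where
  "symmetric_tensors = {A. transpose A = A}"

definition spd_tensors :: "tensor2 set" where
  "spd_tensors = {A \<in> symmetric_tensors. \<forall>v. v \<noteq> 0 \<longrightarrow> 0 < v \<bullet> (A *v v)}"

text \<open>
  The free energy is a function of symmetric tensors, so its derivative is taken
  within the symmetric tensors and represented by the unique symmetric tensor.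
\<close>

definition tensor_derivative :: "(tensor2 \<Rightarrow> real) \<Rightarrow> tensor2 \<Rightarrow> tensor2" where
  "tensor_derivative f C =
    (SOME A. A \<in> symmetric_tensors \<and>
       (f has_derivative (\<lambda>H. A \<bullet> H)) (at C within symmetric_tensors))"

definition identity4 :: tensor4 where
  "identity4 = (\<chi> i j k l. if i = k \<and> j = l then 1 else 0)"

definition dyadic :: "tensor2 \<Rightarrow> tensor2 \<Rightarrow> tensor4" where
  "dyadic A B = (\<chi> i j k l. A $ i $ j * B $ k $ l)"

definition contract4 :: "tensor4 \<Rightarrow> tensor2 \<Rightarrow> tensor2" where
  "contract4 T A = (\<chi> i j. T $ i $ j \<bullet> A)"

definition projection4 :: "tensor2 \<Rightarrow> tensor4" where
  "projection4 C = identity4 - (1/3) *\<^sub>R dyadic (matrix_inv C) C"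

text \<open>
  \<open>J\<close> is kept as an argument: at the mid-point it is the determinant of the mid-point
  deformation gradient, which is not the square root of the determinant of the averaged \<open>C\<close>.
\<close>

definition S_ich :: "(tensor2 \<Rightarrow> real) \<Rightarrow> real \<Rightarrow> tensor2 \<Rightarrow> tensor2" where
  "S_ich Gich J C =
    J powr (-2/3) *\<^sub>R
      contract4 (projection4 C) (2 *\<^sub>R tensor_derivative Gich (J powr (-2/3) *\<^sub>R C))"

definition S_alg ::
  "(tensor2 \<Rightarrow> real) \<Rightarrow> (vec3 \<Rightarrow> tensor2) \<Rightarrow> (vec3 \<Rightarrow> vec3) \<Rightarrow> (vec3 \<Rightarrow> vec3) \<Rightarrow> vec3 \<Rightarrow> tensor2" where
  "S_alg Gich S_enh U0 U1 X =
    S_ich Gich (jac (midpoint_field U0 U1) X) (cauchy_green_mid U0 U1 X) + S_enh X"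


section \<open>The discrete equations and the energy\<close>

definition mass_integrand ::
  "(vec3 \<Rightarrow> vec3) \<Rightarrow> (vec3 \<Rightarrow> vec3) \<Rightarrow> (vec3 \<Rightarrow> real) \<Rightarrow> vec3 \<Rightarrow> real" where
  "mass_integrand Um Vm Q X =
    Q X * jac Um X * (grad Vm X \<bullet> inv_transpose (def_grad Um X))"

definition momentum_integrand ::
  "(vec3 \<Rightarrow> real) \<Rightarrow> (vec3 \<Rightarrow> vec3) \<Rightarrow> (vec3 \<Rightarrow> tensor2) \<Rightarrow> real \<Rightarrow> (vec3 \<Rightarrow> vec3) \<Rightarrow>
   (vec3 \<Rightarrow> real) \<Rightarrow> (vec3 \<Rightarrow> vec3) \<Rightarrow> (vec3 \<Rightarrow> vec3) \<Rightarrow> (vec3 \<Rightarrow> vec3) \<Rightarrow> vec3 \<Rightarrow> real" where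
  "momentum_integrand \<rho>0 Bm S \<Delta>t Um Pm V0 V1 W X =
    W X \<bullet> (\<rho>0 X *\<^sub>R ((V1 X - V0 X) /\<^sub>R \<Delta>t))
    + (transpose (def_grad Um X) ** grad W X) \<bullet> S X
    - jac Um X * Pm X * (grad W X \<bullet> inv_transpose (def_grad Um X))
    - W X \<bullet> (\<rho>0 X *\<^sub>R Bm X)"

definition graddiv_integrand ::
  "real \<Rightarrow> (vec3 \<Rightarrow> vec3) \<Rightarrow> (vec3 \<Rightarrow> vec3) \<Rightarrow> (vec3 \<Rightarrow> vec3) \<Rightarrow> vec3 \<Rightarrow> real" where
  "graddiv_integrand \<gamma> Um Vm W X =
    \<gamma> * jac Um X * (grad W X \<bullet> inv_transpose (def_grad Um X))
                 * (grad Vm X \<bullet> inv_transpose (def_grad Um X))"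

definition energy_density ::
  "(vec3 \<Rightarrow> real) \<Rightarrow> (tensor2 \<Rightarrow> real) \<Rightarrow> (vec3 \<Rightarrow> vec3) \<Rightarrow> (vec3 \<Rightarrow> vec3) \<Rightarrow> vec3 \<Rightarrow> real" where
  "energy_density \<rho>0 Gich U V X =
    1/2 * \<rho>0 X * (norm (V X))\<^sup>2 + Gich (modified_cauchy_green U X)"

definition total_energy ::
  "vec3 set \<Rightarrow> (vec3 \<Rightarrow> real) \<Rightarrow> (tensor2 \<Rightarrow> real) \<Rightarrow> (vec3 \<Rightarrow> vec3) \<Rightarrow> (vec3 \<Rightarrow> vec3) \<Rightarrow> real" where
  "total_energy \<Omega> \<rho>0 Gich U V = (LINT X:\<Omega>|lebesgue. energy_density \<rho>0 Gich U V X)"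

definition dissipation :: "vec3 set \<Rightarrow> real \<Rightarrow> (vec3 \<Rightarrow> vec3) \<Rightarrow> (vec3 \<Rightarrow> vec3) \<Rightarrow> real" where
  "dissipation \<Omega> \<gamma> Um Vm =
    (LINT X:\<Omega>|lebesgue. \<gamma> * jac Um X * (grad Vm X \<bullet> inv_transpose (def_grad Um X))\<^sup>2)"

definition kinematic_equation ::
  "vec3 set \<Rightarrow> real \<Rightarrow> (vec3 \<Rightarrow> vec3) \<Rightarrow> (vec3 \<Rightarrow> vec3) \<Rightarrow> (vec3 \<Rightarrow> vec3) \<Rightarrow> bool" where
  "kinematic_equation \<Omega> \<Delta>t U0 U1 Vm \<longleftrightarrow> (\<forall>X\<in>\<Omega>. 0 = (U1 X - U0 X) /\<^sub>R \<Delta>t - Vm X)"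

text \<open>
  The Bochner integral of a non-integrable function is 0 in HOL, so the equations include the
  existence of their integrals.
\<close>

definition mass_equation ::
  "vec3 set \<Rightarrow> (vec3 \<Rightarrow> vec3) \<Rightarrow> (vec3 \<Rightarrow> vec3) \<Rightarrow> (vec3 \<Rightarrow> real) \<Rightarrow> bool" where
  "mass_equation \<Omega> Um Vm Q \<longleftrightarrow>
    set_integrable lebesgue \<Omega> (mass_integrand Um Vm Q) \<and>
    0 = (LINT X:\<Omega>|lebesgue. mass_integrand Um Vm Q X)"

definition momentum_equation ::
  "vec3 set \<Rightarrow> vec3 set \<Rightarrow> (vec3 \<Rightarrow> real) \<Rightarrow> real \<Rightarrow> (vec3 \<Rightarrow> vec3) \<Rightarrow> (vec3 \<Rightarrow> vec3) \<Rightarrow>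
   (vec3 \<Rightarrow> tensor2) \<Rightarrow> real \<Rightarrow> (vec3 \<Rightarrow> vec3) \<Rightarrow> (vec3 \<Rightarrow> real) \<Rightarrow> (vec3 \<Rightarrow> vec3) \<Rightarrow>
   (vec3 \<Rightarrow> vec3) \<Rightarrow> (vec3 \<Rightarrow> vec3) \<Rightarrow> bool" where
  "momentum_equation \<Omega> \<Gamma>H \<rho>0 \<gamma> Bm Hm S \<Delta>t Um Pm V0 V1 W \<longleftrightarrow>
    set_integrable lebesgue \<Omega> (momentum_integrand \<rho>0 Bm S \<Delta>t Um Pm V0 V1 W) \<and>
    set_integrable surface_measure \<Gamma>H (\<lambda>X. W X \<bullet> Hm X) \<and>
    set_integrable lebesgue \<Omega> (graddiv_integrand \<gamma> Um (midpoint_field V0 V1) W) \<and>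
    0 = (LINT X:\<Omega>|lebesgue. momentum_integrand \<rho>0 Bm S \<Delta>t Um Pm V0 V1 W X)
        - (LINT X:\<Gamma>H|surface_measure. W X \<bullet> Hm X)
        + (LINT X:\<Omega>|lebesgue. graddiv_integrand \<gamma> Um (midpoint_field V0 V1) W X)"

end

theory Submission
  imports Defs
begin

text \<open>
  Testing the momentum equation with the mid-point velocity and the mass equation with the
  mid-point pressure removes the pressure term.  By the kinematic equation, the gradient of the
  mid-point velocity is the difference quotient of the deformation gradients; since the algorithmic
  stress is symmetric, its power is its contraction with half the increment of \<open>C\<close> divided by
  \<open>\<Delta>t\<close>, which directionality turns into the increment of the free energy.

  The gradients are meaningful only where the discrete functions are differentiable.  This holds
  almost everywhere: a NURBS function is rational with nonvanishing denominator off the knot planes,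
  and the inverse of the geometrical map is differentiable off the critical values, which are null
  by Sard's theorem.
\<close>

section \<open>NURBS functions\<close>

lemma set_concat_replicate_subset:
  "set (concat (map2 (\<lambda>z a. replicate (f a) z) Z \<alpha>)) \<subseteq> set Z"
  by (auto dest: set_zip_leftD)

lemma sorted_concat_replicate:
  "sorted Z \<Longrightarrow> sorted (concat (map2 (\<lambda>z a. replicate (f a) z) Z \<alpha>))"
proof (induction Z arbitrary: \<alpha>)
  case (Cons z Z)
  show ?case
  proof (cases \<alpha>)
    case (Cons a \<alpha>')
    have "\<forall>y\<in>set (concat (map2 (\<lambda>z a. replicate (f a) z) Z \<alpha>')). z \<le> y"
      using Cons.prems set_concat_replicate_subset[of f Z \<alpha>'] by auto
    moreover have "sorted (concat (map2 (\<lambda>z a. replicate (f a) z) Z \<alpha>'))"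
      using Cons.prems by (intro Cons.IH) simp
    ultimately show ?thesis
      using \<open>\<alpha> = a # \<alpha>'\<close> by (auto simp: sorted_append)
  qed simp
qed simp

lemma knot_vector_sorted:
  assumes "sorted Z" "set Z \<subseteq> {0<..<1}"
  shows "sorted (knot_vector q Z \<alpha>)"
proof -
  have "set (concat (map2 (\<lambda>z a. replicate (nat (int q - a)) z) Z \<alpha>)) \<subseteq> {0<..<1}"
    using set_concat_replicate_subset assms(2) by (rule subset_trans)
  then have "0 < y" "y < 1"
    if "y \<in> set (concat (map2 (\<lambda>z a. replicate (nat (int q - a)) z) Z \<alpha>))" for y
    using that by (meson greaterThanLessThan_iff subsetD)+
  with sorted_concat_replicate[OF assms(1)] show ?thesis
    unfolding knot_vector_def sorted_append by (auto simp: less_imp_le simp del: set_concat)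
qed

lemma set_knot_vector_subset: "set (knot_vector q Z \<alpha>) \<subseteq> insert 0 (insert 1 (set Z))"
proof -
  have "set (concat (map2 (\<lambda>z a. replicate (nat (int q - a)) z) Z \<alpha>)) \<subseteq> set Z"
    by (rule set_concat_replicate_subset)
  then show ?thesis
    unfolding knot_vector_def by (auto simp del: set_concat)
qed

text \<open>The index \<open>length \<Xi> - q - 1\<close> is that of the first of the
  \<open>q + 1\<close> closing ones; it is also the number of basis functions.\<close>

lemma knot_vector_open:
  fixes q Z \<alpha>
  defines "\<Xi> \<equiv> knot_vector q Z \<alpha>"
  shows "q + 1 < length \<Xi> - q" "\<Xi> ! 0 = 0" "\<Xi> ! (length \<Xi> - q - 1) = 1"
  by (auto simp: \<Xi>_def knot_vector_def nth_append)

text \<open>The span ends at the first knot exceeding \<open>x\<close>. Searching only up to the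
  first closing 1 makes \<open>k\<close> the index of a basis function, and both inequalities are
  strict because \<open>x\<close> is not a knot.\<close>

lemma knot_span_exists:
  assumes x: "0 < x" "x < 1" "x \<notin> set (knot_vector q Z \<alpha>)"
  obtains k where "k < length (knot_vector q Z \<alpha>) - q - 1"
    "knot_vector q Z \<alpha> ! k < x" "x < knot_vector q Z \<alpha> ! (k + 1)"
proof -
  let ?\<Xi> = "knot_vector q Z \<alpha>"
  let ?P = "\<lambda>n. x < ?\<Xi> ! n"
  have "\<not> ?P 0" "?P (length ?\<Xi> - q - 1)"
    using x knot_vector_open[of q Z \<alpha>] by auto
  then obtain k where k: "k < length ?\<Xi> - q - 1" "\<forall>i\<le>k. \<not> ?P i" "?P (k + 1)"
    using ex_least_nat_less[of ?P] by auto
  moreover have "?\<Xi> ! k \<noteq> x"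
    using k(1) x(3) nth_mem[of k ?\<Xi>] by fastforce
  ultimately show thesis
    using that by force
qed

section \<open>Univariate B-splines\<close>

text \<open>Sign and support are proved together: a coefficient of the Cox--de Boor recursion can be
  negative, but only where the spline that it multiplies vanishes.\<close>

lemma bspline_support_nonneg:
  assumes "sorted \<Xi>" "i + q + 1 < length \<Xi>"
  shows "0 \<le> bspline \<Xi> i q x \<and>
    (bspline \<Xi> i q x \<noteq> 0 \<longrightarrow> \<Xi> ! i \<le> x \<and> x \<le> \<Xi> ! (i + q + 1))"
  using assms(2)
proof (induction q arbitrary: i)
  case 0
  show ?case by auto
next
  case (Suc q)
  have mono: "\<Xi> ! i \<le> \<Xi> ! (i + 1)" "\<Xi> ! i \<le> \<Xi> ! (i + q + 1)" "\<Xi> ! (i + q + 1) \<le> \<Xi> ! (i + q + 2)"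
      "\<Xi> ! (i + 1) \<le> \<Xi> ! (i + q + 2)"
    using Suc.prems by (auto intro!: sorted_nth_mono[OF assms(1)])
  have IH: "0 \<le> bspline \<Xi> i q x \<and>
      (bspline \<Xi> i q x \<noteq> 0 \<longrightarrow> \<Xi> ! i \<le> x \<and> x \<le> \<Xi> ! (i + q + 1))"
    "0 \<le> bspline \<Xi> (i + 1) q x \<and>
      (bspline \<Xi> (i + 1) q x \<noteq> 0 \<longrightarrow> \<Xi> ! (i + 1) \<le> x \<and> x \<le> \<Xi> ! (i + q + 2))"
    using Suc.IH[of i] Suc.IH[of "i + 1"] Suc.prems by (auto simp: numeral_2_eq_2)
  \<comment> \<open>Where the lower-degree spline is nonzero, its support bounds make the numerator
    nonnegative; a zero denominator makes the quotient 0.\<close>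
  have "0 \<le> (x - \<Xi> ! i) / (\<Xi> ! (i + q + 1) - \<Xi> ! i) * bspline \<Xi> i q x"
    using IH(1) mono by (cases "bspline \<Xi> i q x = 0") auto
  moreover have "0 \<le> (\<Xi> ! (i + q + 2) - x) / (\<Xi> ! (i + q + 2) - \<Xi> ! (i + 1)) * bspline \<Xi> (i + 1) q x"
    using IH(2) mono by (cases "bspline \<Xi> (i + 1) q x = 0") auto
  moreover have "\<Xi> ! i \<le> x \<and> x \<le> \<Xi> ! (i + Suc q + 1)" if "bspline \<Xi> i (Suc q) x \<noteq> 0"
  proof -
    have "bspline \<Xi> i q x \<noteq> 0 \<or> bspline \<Xi> (i + 1) q x \<noteq> 0"
      using that by auto
    then show ?thesis
      using IH mono by auto
  qed
  ultimately show ?case by simp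
qed

lemma bspline_nonneg:
  "sorted \<Xi> \<Longrightarrow> i + q + 1 < length \<Xi> \<Longrightarrow> 0 \<le> bspline \<Xi> i q x"
  using bspline_support_nonneg by blast

text \<open>On the first span of the support, the first summand of the recursion stays positive as
  the degree grows and the second is nonnegative. This is what keeps the NURBS denominator
  nonzero.\<close>

lemma bspline_pos_first_span:
  assumes "sorted \<Xi>" "k + q + 1 < length \<Xi>" "\<Xi> ! k < x" "x < \<Xi> ! (k + 1)"
  shows "0 < bspline \<Xi> k q x"
  using assms(2)
proof (induction q)
  case 0
  show ?case using assms by simp
next
  case (Suc q)
  have mono: "\<Xi> ! (k + 1) \<le> \<Xi> ! (k + q + 1)" "\<Xi> ! (k + q + 1) \<le> \<Xi> ! (k + q + 2)"
    using Suc.prems by (auto intro!: sorted_nth_mono[OF assms(1)])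
  have "0 < (x - \<Xi> ! k) / (\<Xi> ! (k + q + 1) - \<Xi> ! k) * bspline \<Xi> k q x"
    using Suc assms mono by (intro mult_pos_pos divide_pos_pos) auto
  moreover have "0 \<le> (\<Xi> ! (k + q + 2) - x) / (\<Xi> ! (k + q + 2) - \<Xi> ! (k + 1)) * bspline \<Xi> (k + 1) q x"
    using Suc.prems assms mono
    by (intro mult_nonneg_nonneg divide_nonneg_nonneg bspline_nonneg) auto
  ultimately show ?case by simp
qed

text \<open>Off the knots, degree 0 is locally constant, and the recursion only multiplies by affine
  functions and adds.\<close>

lemma bspline_differentiable:
  assumes "x \<notin> set \<Xi>" "i + q + 1 < length \<Xi>"
  shows "bspline \<Xi> i q differentiable (at x)"
  using assms(2)
proof (induction q arbitrary: i)
  case 0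
  have "\<Xi> ! i \<in> set \<Xi>" "\<Xi> ! (i + 1) \<in> set \<Xi>"
    using 0 by auto
  then have x: "\<Xi> ! i \<noteq> x" "\<Xi> ! (i + 1) \<noteq> x"
    using assms(1) by metis+
  \<comment> \<open>Every point of \<open>T\<close> lies strictly on the same side of both knots as
    \<open>x\<close>, so the clause that closes the last span on the right is never met in
    \<open>T\<close>.\<close>
  define T where "T = (if x < \<Xi> ! i then {..<\<Xi> ! i} else {\<Xi> ! i<..}) \<inter>
    (if x < \<Xi> ! (i + 1) then {..<\<Xi> ! (i + 1)} else {\<Xi> ! (i + 1)<..})"
  have T: "open T" "x \<in> T" "\<And>y. y \<in> T \<Longrightarrow> bspline \<Xi> i 0 x = bspline \<Xi> i 0 y"
    using x by (auto simp: T_def split: if_splits)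
  have "((\<lambda>_. bspline \<Xi> i 0 x) has_derivative (\<lambda>_. 0)) (at x)"
    by simp
  then have "(bspline \<Xi> i 0 has_derivative (\<lambda>_. 0)) (at x)"
    by (rule has_derivative_transform_within_open[OF _ T])
  then show ?case
    by (rule differentiableI)
next
  case (Suc q)
  have "bspline \<Xi> i q differentiable (at x)" "bspline \<Xi> (i + 1) q differentiable (at x)"
    using Suc.IH[of i] Suc.IH[of "i + 1"] Suc.prems by auto
  \<comment> \<open>Written as constant inverse factors, the denominators require no case
    distinction for repeated knots.\<close>
  then show ?case
    unfolding bspline.simps(2)[abs_def] divide_inverse
    by (intro differentiable_add differentiable_mult differentiable_diff differentiable_ident
        differentiable_const)
qed

section \<open>Tensor-product B-splines and NURBS\<close>

lemma finite_basis_indices: "finite (basis_indices q Z \<alpha>)"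
proof -
  have "basis_indices q Z \<alpha> = Pi\<^sub>E UNIV (\<lambda>d. {..<length (knot_vector (q d) (Z d) (\<alpha> d)) - q d - 1})"
    by (auto simp: basis_indices_def PiE_def)
  then show ?thesis
    by (simp add: finite_PiE)
qed

lemma basis_indices_length:
  assumes "i \<in> basis_indices q Z \<alpha>"
  shows "i d + q d + 1 < length (knot_vector (q d) (Z d) (\<alpha> d))"
proof -
  have "i d < length (knot_vector (q d) (Z d) (\<alpha> d)) - q d - 1"
    using assms by (simp add: basis_indices_def)
  then show ?thesis by linarith
qed

lemma tensor_bspline_differentiable:
  assumes "\<And>d. \<xi> $ d \<notin> set (knot_vector (q d) (Z d) (\<alpha> d))" "i \<in> basis_indices q Z \<alpha>"
  shows "tensor_bspline q Z \<alpha> i differentiable (at \<xi>)"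
proof -
  have "(\<lambda>\<xi>. bspline (knot_vector (q d) (Z d) (\<alpha> d)) (i d) (q d) (\<xi> $ d)) differentiable (at \<xi>)" for d
  proof -
    have "i d + q d + 1 < length (knot_vector (q d) (Z d) (\<alpha> d))"
      using assms(2) by (rule basis_indices_length)
    from bspline_differentiable[OF assms(1) this] obtain D
      where "(bspline (knot_vector (q d) (Z d) (\<alpha> d)) (i d) (q d) has_derivative D) (at (\<xi> $ d))"
      unfolding differentiable_def by blast
    from has_derivative_compose[OF bounded_linear.has_derivative[OF bounded_linear_vec_nth has_derivative_ident] this]
    show ?thesis
      by (auto simp: differentiable_def)
  qed
  then obtain D where D: "\<And>d. ((\<lambda>\<xi>. bspline (knot_vector (q d) (Z d) (\<alpha> d)) (i d) (q d) (\<xi> $ d))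
      has_derivative D d) (at \<xi>)"
    unfolding differentiable_def by metis
  show ?thesis
    unfolding tensor_bspline_def[abs_def] differentiable_def
    by (rule exI, rule has_derivative_prod, rule D)
qed

text \<open>All summands are nonnegative. The one whose index collects the knot spans containing the
  coordinates of \<open>\<xi>\<close> is positive, each factor being evaluated in the first span of
  its support.\<close>

lemma weighted_tensor_bspline_sum_pos:
  assumes mesh: "\<And>d. sorted (Z d)" "\<And>d. set (Z d) \<subseteq> {0<..<1}"
    and weights: "positive_weights q Z \<alpha> w"
    and \<xi>: "\<xi> \<in> box 0 1" "\<And>d. \<xi> $ d \<notin> set (knot_vector (q d) (Z d) (\<alpha> d))"
  shows "0 < (\<Sum>j\<in>basis_indices q Z \<alpha>. w j * tensor_bspline q Z \<alpha> j \<xi>)"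
proof -
  let ?\<Xi> = "\<lambda>d. knot_vector (q d) (Z d) (\<alpha> d)"
  have sorted: "sorted (?\<Xi> d)" for d
    using mesh by (rule knot_vector_sorted)
  have "\<exists>k. k < length (?\<Xi> d) - q d - 1 \<and> ?\<Xi> d ! k < \<xi> $ d \<and> \<xi> $ d < ?\<Xi> d ! (k + 1)" for d
  proof -
    have "0 < \<xi> $ d" "\<xi> $ d < 1"
      using \<xi>(1) by (auto simp: mem_box_cart)
    from knot_span_exists[OF this \<xi>(2)[of d]] show ?thesis by blast
  qed
  then obtain k where k: "\<And>d. k d < length (?\<Xi> d) - q d - 1" "\<And>d. ?\<Xi> d ! k d < \<xi> $ d"
      "\<And>d. \<xi> $ d < ?\<Xi> d ! (k d + 1)"
    by metis
  have "k \<in> basis_indices q Z \<alpha>"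
    using k(1) by (simp add: basis_indices_def)
  moreover from this have "0 < tensor_bspline q Z \<alpha> k \<xi>"
    unfolding tensor_bspline_def using sorted k(2,3) basis_indices_length
    by (intro prod_pos ballI bspline_pos_first_span) auto
  moreover have "0 \<le> tensor_bspline q Z \<alpha> j \<xi>" if "j \<in> basis_indices q Z \<alpha>" for j
    unfolding tensor_bspline_def using sorted basis_indices_length[OF that]
    by (intro prod_nonneg ballI bspline_nonneg)
  ultimately show ?thesis
    using weights unfolding positive_weights_def
    by (intro sum_pos2[OF finite_basis_indices]) (auto simp: less_imp_le)
qed

text \<open>Inside the open cube the end knots 0 and 1 are avoided, so missing the breakpoints
  suffices; the quotient rule then applies with a positive denominator.\<close>

lemma nurbs_differentiable:
  assumes f: "f \<in> nurbs_space q Z \<alpha> w"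
    and mesh: "\<And>d. sorted (Z d)" "\<And>d. set (Z d) \<subseteq> {0<..<1}"
    and weights: "positive_weights q Z \<alpha> w"
    and \<xi>: "\<xi> \<in> box 0 1" "\<And>d. \<xi> $ d \<notin> set (Z d)"
  shows "f differentiable (at \<xi>)"
proof -
  obtain c where f: "f = (\<lambda>\<xi>. \<Sum>i\<in>basis_indices q Z \<alpha>. c i * nurbs_basis q Z \<alpha> w i \<xi>)"
    using f by (auto simp: nurbs_space_def)
  have "0 < \<xi> $ d \<and> \<xi> $ d < 1" for d
    using \<xi>(1) by (auto simp: mem_box_cart)
  then have knots: "\<xi> $ d \<notin> set (knot_vector (q d) (Z d) (\<alpha> d))" for d
    using \<xi>(2) set_knot_vector_subset[of "q d" "Z d" "\<alpha> d"]
    by (metis insertE order_less_irrefl subsetD)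
  have "(\<Sum>j\<in>basis_indices q Z \<alpha>. w j * tensor_bspline q Z \<alpha> j \<xi>) \<noteq> 0"
    using weighted_tensor_bspline_sum_pos[OF mesh weights \<xi>(1) knots] by simp
  then show ?thesis
    unfolding f nurbs_basis_def using knots
    by (intro differentiable_sum[OF finite_basis_indices] ballI differentiable_mult[OF differentiable_const]
        differentiable_divide tensor_bspline_differentiable)
qed

section \<open>Mid-points of discrete functions\<close>

text \<open>Both functions share the weights and hence the denominator, so the coefficients can be
  averaged. Closure under mid-points is what admits \<open>Vm\<close> and \<open>Pm\<close> as test
  functions.\<close>

lemma nurbs_space_midpoint:
  assumes "f \<in> nurbs_space q Z \<alpha> w" "g \<in> nurbs_space q Z \<alpha> w"
  shows "(\<lambda>\<xi>. (f \<xi> + g \<xi>) / 2) \<in> nurbs_space q Z \<alpha> w"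
proof -
  obtain c c' where
    "f = (\<lambda>\<xi>. \<Sum>i\<in>basis_indices q Z \<alpha>. c i * nurbs_basis q Z \<alpha> w i \<xi>)"
    "g = (\<lambda>\<xi>. \<Sum>i\<in>basis_indices q Z \<alpha>. c' i * nurbs_basis q Z \<alpha> w i \<xi>)"
    using assms by (auto simp: nurbs_space_def)
  then have "(\<lambda>\<xi>. (f \<xi> + g \<xi>) / 2) =
      (\<lambda>\<xi>. \<Sum>i\<in>basis_indices q Z \<alpha>. ((c i + c' i) / 2) * nurbs_basis q Z \<alpha> w i \<xi>)"
    by (simp add: sum.distrib add_divide_distrib distrib_right sum_divide_distrib)
  then show ?thesis
    unfolding nurbs_space_def by (intro CollectI exI)
qed

lemma push_forward_midpoint:
  assumes "W1 \<in> push_forward \<psi> R" "W2 \<in> push_forward \<psi> R"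
    and "\<And>f g. f \<in> R \<Longrightarrow> g \<in> R \<Longrightarrow> midpoint_field f g \<in> R"
  shows "midpoint_field W1 W2 \<in> push_forward \<psi> R"
proof -
  obtain f g where "f \<in> R" "g \<in> R" "\<forall>\<xi>\<in>cbox 0 1. W1 (\<psi> \<xi>) = f \<xi>" "\<forall>\<xi>\<in>cbox 0 1. W2 (\<psi> \<xi>) = g \<xi>"
    using assms(1,2) unfolding push_forward_def by blast
  then show ?thesis
    using assms(3)[of f g] unfolding push_forward_def
    by (auto intro!: bexI[of _ "midpoint_field f g"] simp: midpoint_field_def)
qed

lemma P_hat_midpoint:
  "f \<in> P_hat p Z r w \<Longrightarrow> g \<in> P_hat p Z r w \<Longrightarrow> midpoint_field f g \<in> P_hat p Z r w"
  using nurbs_space_midpoint[of f _ Z r w g] by (simp add: P_hat_def midpoint_field_def[abs_def])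

lemma S_hat_midpoint:
  "f \<in> S_hat p a b Z r w \<Longrightarrow> g \<in> S_hat p a b Z r w \<Longrightarrow> midpoint_field f g \<in> S_hat p a b Z r w"
  by (auto simp: S_hat_def midpoint_field_def intro: nurbs_space_midpoint)

lemma S_hat_differentiable:
  assumes f: "f \<in> S_hat p a b Z r w"
    and mesh: "\<And>d. sorted (Z d)" "\<And>d. set (Z d) \<subseteq> {0<..<1}"
    and weights: "positive_weights (\<lambda>_. p + a) Z (raise_regularity b r) w"
    and \<xi>: "\<xi> \<in> box 0 1" "\<And>d. \<xi> $ d \<notin> set (Z d)"
  shows "f differentiable (at \<xi>)"
proof -
  have "(\<lambda>x. f x $ i) differentiable (at \<xi>)" for i
    using f nurbs_differentiable[OF _ mesh weights \<xi>] by (simp add: S_hat_def)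
  then show ?thesis
    by (subst differentiable_componentwise_within) (auto simp: Basis_vec_def inner_axis)
qed

section \<open>Almost everywhere differentiability on the physical domain\<close>

lemma geometrical_map_differentiable:
  assumes "geometrical_map \<Omega> \<psi>" "\<xi> \<in> box 0 1"
  shows "\<psi> differentiable (at \<xi>)"
proof -
  have "C_k_on (Suc 0) (box 0 1) \<psi>"
    using assms(1) unfolding geometrical_map_def smooth_on_def by blast
  then show ?thesis
    using assms(2) by simp
qed

text \<open>At a noncritical point the derivative has a linear left inverse, and a continuous
  inverse of the map is then differentiable with that derivative.\<close>

lemma geometrical_map_inverse_differentiable:
  assumes map: "geometrical_map \<Omega> \<psi>" and "open \<Omega>" and \<xi>: "\<xi> \<in> box 0 1"
    and \<psi>': "(\<psi> has_derivative \<psi>') (at \<xi>)" "det (matrix \<psi>') \<noteq> 0"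
  shows "inv_into (cbox 0 1) \<psi> differentiable (at (\<psi> \<xi>))"
proof -
  let ?g = "inv_into (cbox 0 1) \<psi>"
  have bij: "bij_betw \<psi> (box 0 1) \<Omega>" "bij_betw \<psi> (cbox 0 1) (closure \<Omega>)"
    and cont: "continuous_on (cbox 0 1) \<psi>"
    using map by (auto simp: geometrical_map_def)
  have inj: "inj_on \<psi> (cbox 0 1)" and img: "\<psi> ` cbox 0 1 = closure \<Omega>"
    using bij(2) by (auto simp: bij_betw_def)
  have \<xi>': "\<xi> \<in> cbox 0 1" "\<psi> \<xi> \<in> \<Omega>"
    using \<xi> bij(1) box_subset_cbox by (auto simp: bij_betw_def)
  \<comment> \<open>Continuity of the inverse comes from compactness, which is why the inverse is
    taken on the closed cube.\<close>
  have "continuous_on (closure \<Omega>) ?g"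
    using continuous_on_inv[OF cont compact_cbox, of ?g] img inj by auto
  then have "continuous (at (\<psi> \<xi>)) ?g"
    using \<xi>'(2) \<open>open \<Omega>\<close> closure_subset
    by (metis continuous_on_eq_continuous_at continuous_on_subset)
  moreover have "linear \<psi>'"
    using \<psi>'(1) has_derivative_linear by blast
  then have "\<exists>g'. linear g' \<and> g' \<circ> \<psi>' = id"
    using \<psi>'(2) by (simp add: det_nz_iff_inj linear_injective_left_inverse)
  then obtain g' where "linear g'" "g' \<circ> \<psi>' = id" by blast
  moreover have "(\<psi> has_derivative \<psi>') (at (?g (\<psi> \<xi>)))"
    using \<psi>'(1) inj \<xi>'(1) by simp
  moreover have "\<psi> (?g z) = z" if "z \<in> \<Omega>" for z
    using that img closure_subset by (metis f_inv_into_f subsetD)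
  ultimately have "(?g has_derivative g') (at (\<psi> \<xi>))"
    using \<open>open \<Omega>\<close> \<xi>'(2) by (intro has_derivative_inverse_basic[of \<psi> \<psi>' ?g "\<psi> \<xi>" g' \<Omega>])
      (auto simp: linear_conv_bounded_linear)
  then show ?thesis
    by (rule differentiableI)
qed

lemma negligible_knot_planes: "negligible {\<xi>::real^'n. \<exists>d. \<xi> $ d \<in> set (Z d)}"
proof -
  have "{\<xi>::real^'n. \<exists>d. \<xi> $ d \<in> set (Z d)} = (\<Union>d. \<Union>z\<in>set (Z d). {\<xi>. \<xi> $ d = z})"
    by auto
  moreover have "negligible {\<xi>::real^'n. \<xi> $ d = z}" for d z
    using negligible_standard_hyperplane[of "axis d 1::real^'n" z] by (auto simp: inner_axis Basis_vec_def)
  ultimately show ?thesis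
    by (auto intro!: negligible_Union)
qed

text \<open>A bad point is the image of a point on a knot plane (\<open>K\<close>) or of a critical
  point (\<open>C\<close>). The first image is null because a differentiable map between spaces of
  equal dimension preserves null sets, the second by Sard.\<close>

lemma AE_regular_point:
  assumes map: "geometrical_map \<Omega> \<psi>" and "open \<Omega>"
  shows "AE X in lebesgue. X \<in> \<Omega> \<longrightarrow>
    (\<exists>\<xi>\<in>box 0 1. \<psi> \<xi> = X \<and> (\<forall>d. \<xi> $ d \<notin> set (Z d)) \<and>
       inv_into (cbox 0 1) \<psi> differentiable (at X))"
proof -
  let ?D = "\<lambda>\<xi>. frechet_derivative \<psi> (at \<xi>)"
  define K where "K = {\<xi>\<in>box 0 1. \<exists>d. \<xi> $ d \<in> set (Z d)}"
  define C where "C = {\<xi>\<in>box 0 1. det (matrix (?D \<xi>)) = 0}"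
  have diff: "(\<psi> has_derivative ?D \<xi>) (at \<xi>)" if "\<xi> \<in> box 0 1" for \<xi>
    using geometrical_map_differentiable[OF map that] frechet_derivative_works by blast
  have "negligible K"
    by (rule negligible_subset[OF negligible_knot_planes[of Z]]) (auto simp: K_def)
  then have "negligible (\<psi> ` K)"
    using geometrical_map_differentiable[OF map]
    by (intro negligible_differentiable_image_negligible)
      (auto simp: K_def differentiable_on_def intro: differentiable_at_withinI)
  moreover have "negligible (\<psi> ` C)"
  proof (rule baby_Sard)
    fix \<xi> assume "\<xi> \<in> C"
    then show "(\<psi> has_derivative ?D \<xi>) (at \<xi> within C)"
      using diff by (simp add: C_def has_derivative_at_withinI)
    show "rank (matrix (?D \<xi>)) < CARD(3)"
      using \<open>\<xi> \<in> C\<close> det_eq_0_rank[of "matrix (?D \<xi>)"] by (simp add: C_def)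
  qed simp
  ultimately have "\<psi> ` K \<union> \<psi> ` C \<in> null_sets lebesgue"
    by (simp add: null_sets.Un flip: negligible_iff_null_sets)
  then show ?thesis
  proof (rule AE_I')
    show "{X \<in> space lebesgue. \<not> (X \<in> \<Omega> \<longrightarrow> (\<exists>\<xi>\<in>box 0 1. \<psi> \<xi> = X \<and>
        (\<forall>d. \<xi> $ d \<notin> set (Z d)) \<and> inv_into (cbox 0 1) \<psi> differentiable (at X)))}
      \<subseteq> \<psi> ` K \<union> \<psi> ` C"
      (is "{X \<in> space lebesgue. \<not> (X \<in> \<Omega> \<longrightarrow> ?R X)} \<subseteq> _")
    proof
      fix X assume "X \<in> {X \<in> space lebesgue. \<not> (X \<in> \<Omega> \<longrightarrow> ?R X)}"
      then have X: "X \<in> \<Omega>" "\<not> ?R X" by auto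
      then obtain \<xi> where \<xi>: "\<xi> \<in> box 0 1" "\<psi> \<xi> = X"
        using map by (auto simp: geometrical_map_def bij_betw_def)
      show "X \<in> \<psi> ` K \<union> \<psi> ` C"
      proof (cases "\<xi> \<in> C")
        case True
        then show ?thesis using \<xi>(2) by blast
      next
        case False
        then have "inv_into (cbox 0 1) \<psi> differentiable (at X)"
          using geometrical_map_inverse_differentiable[OF map \<open>open \<Omega>\<close> \<xi>(1) diff[OF \<xi>(1)]] \<xi>
          by (simp add: C_def)
        then have "\<xi> \<in> K"
          using X(2) \<xi> by (auto simp: K_def)
        then show ?thesis using \<xi>(2) by blast
      qed
    qed
  qed
qed

text \<open>On the open set \<open>\<Omega>\<close> the function \<open>W\<close> is
  \<open>f\<close> composed with the inverse map, so the chain rule applies.\<close>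

lemma push_forward_differentiable:
  assumes map: "geometrical_map \<Omega> \<psi>" and "open \<Omega>" and \<xi>: "\<xi> \<in> box 0 1"
    and g: "inv_into (cbox 0 1) \<psi> differentiable (at (\<psi> \<xi>))"
    and f: "f differentiable (at \<xi>)" "\<And>\<xi>. \<xi> \<in> cbox 0 1 \<Longrightarrow> W (\<psi> \<xi>) = f \<xi>"
  shows "W differentiable (at (\<psi> \<xi>))"
proof -
  let ?g = "inv_into (cbox 0 1) \<psi>"
  have bij: "bij_betw \<psi> (box 0 1) \<Omega>" "bij_betw \<psi> (cbox 0 1) (closure \<Omega>)"
    using map by (auto simp: geometrical_map_def)
  have "\<psi> \<xi> \<in> \<Omega>" "?g (\<psi> \<xi>) = \<xi>"
    using \<xi> bij box_subset_cbox[of 0 1] by (auto simp: bij_betw_def)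
  then have "f \<circ> ?g differentiable (at (\<psi> \<xi>))"
    using f(1) g by (intro differentiable_chain_at) auto
  then obtain D where "(f \<circ> ?g has_derivative D) (at (\<psi> \<xi>))"
    unfolding differentiable_def by blast
  moreover have "(f \<circ> ?g) X = W X" if "X \<in> \<Omega>" for X
  proof -
    have "X \<in> \<psi> ` cbox 0 1"
      using that bij(2) closure_subset by (auto simp: bij_betw_def)
    then show ?thesis
      using f(2)[of "?g X"] by (simp add: f_inv_into_f inv_into_into)
  qed
  ultimately have "(W has_derivative D) (at (\<psi> \<xi>))"
    using has_derivative_transform_within_open \<open>open \<Omega>\<close> \<open>\<psi> \<xi> \<in> \<Omega>\<close> by blast
  then show ?thesis
    by (rule differentiableI)
qed

lemma push_forward_S_hat_differentiable:
  assumes map: "geometrical_map \<Omega> \<psi>" and "open \<Omega>"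
    and mesh: "\<And>d. valid_mesh p (Z d) (r d)"
    and weights: "positive_weights (\<lambda>_. p + a) Z (raise_regularity b r) w"
    and W: "W \<in> push_forward \<psi> (S_hat p a b Z r w)"
  shows "AE X in lebesgue. X \<in> \<Omega> \<longrightarrow> W differentiable (at X)"
proof -
  obtain f where f: "f \<in> S_hat p a b Z r w" "\<And>\<xi>. \<xi> \<in> cbox 0 1 \<Longrightarrow> W (\<psi> \<xi>) = f \<xi>"
    using W by (auto simp: push_forward_def)
  have Z: "sorted (Z d)" "set (Z d) \<subseteq> {0<..<1}" for d
    using mesh[of d] by (auto simp: valid_mesh_def strict_sorted_imp_sorted)
  show ?thesis
    using AE_regular_point[OF map \<open>open \<Omega>\<close>, of Z]
  proof (eventually_elim, intro impI)
    fix X assume *: "X \<in> \<Omega> \<longrightarrow> (\<exists>\<xi>\<in>box 0 1. \<psi> \<xi> = X \<and> (\<forall>d. \<xi> $ d \<notin> set (Z d)) \<and>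
       inv_into (cbox 0 1) \<psi> differentiable (at X))" "X \<in> \<Omega>"
    then obtain \<xi> where \<xi>: "\<xi> \<in> box 0 1" "\<psi> \<xi> = X" "\<And>d. \<xi> $ d \<notin> set (Z d)"
        "inv_into (cbox 0 1) \<psi> differentiable (at (\<psi> \<xi>))"
      by blast
    show "W differentiable (at X)"
      using push_forward_differentiable[OF map \<open>open \<Omega>\<close> \<xi>(1,4) S_hat_differentiable[OF f(1) Z weights \<xi>(1,3)] f(2)]
        \<xi>(2) by simp
  qed
qed

section \<open>Symmetry of the algorithmic stress and its power\<close>

lemma inner_matrix: "(A::real^'n^'m) \<bullet> B = (\<Sum>i\<in>UNIV. \<Sum>j\<in>UNIV. A $ i $ j * B $ i $ j)"
  by (simp add: inner_vec_def)

lemma inner_transpose: "transpose (A::real^'n^'m) \<bullet> transpose B = A \<bullet> B"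
  unfolding inner_matrix transpose_def by (simp, rule sum.swap)

lemma symmetric_contract_transpose:
  assumes "S \<in> symmetric_tensors"
  shows "transpose A \<bullet> S = A \<bullet> S"
  using inner_transpose[of A S] assms by (simp add: symmetric_tensors_def)

lemma transpose_add: "transpose (A + B) = transpose A + transpose (B::'a::semiring_1^'n^'m)"
  by (simp add: transpose_def vec_eq_iff)

lemma subspace_symmetric_tensors: "subspace symmetric_tensors"
  by (auto simp: subspace_def symmetric_tensors_def transpose_add transpose_scalar)
     (simp add: transpose_def vec_eq_iff)

text \<open>The transposed inverse is again a left inverse of \<open>C\<close>, and inverses are
  unique.\<close>

lemma symmetric_tensors_matrix_inv:
  assumes "C \<in> symmetric_tensors" "invertible C"
  shows "matrix_inv C \<in> symmetric_tensors"
proof -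
  have inv: "C ** matrix_inv C = mat 1 \<and> matrix_inv C ** C = mat 1"
    using assms(2) unfolding invertible_def matrix_inv_def by (rule someI_ex)
  then have "transpose (matrix_inv C) ** C = mat 1"
    using assms(1) matrix_transpose_mul[of C "matrix_inv C"] by (simp add: symmetric_tensors_def)
  then have "transpose (matrix_inv C) = matrix_inv C"
    using inv by (metis matrix_mul_assoc matrix_mul_lid matrix_mul_rid)
  then show ?thesis
    by (simp add: symmetric_tensors_def)
qed

section \<open>Positive definite tensors and symmetry of the stress\<close>

lemma spd_invertible:
  assumes "C \<in> spd_tensors"
  shows "invertible C"
proof -
  have "inj ((*v) C)"
  proof (rule injI)
    fix x y assume "C *v x = C *v y"
    then have "(x - y) \<bullet> (C *v (x - y)) = 0"
      by (simp add: matrix_vector_mult_diff_distrib)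
    then show "x = y"
      using assms unfolding spd_tensors_def
      by (metis (mono_tags, lifting) eq_iff_diff_eq_0 less_irrefl mem_Collect_eq)
  qed
  then show ?thesis
    by (simp add: invertible_left_inverse matrix_left_invertible_injective)
qed

text \<open>The quadratic form of \<open>C\<close> at \<open>v\<close> is the squared norm of
  \<open>F *v v\<close>, and \<open>F\<close> is injective.\<close>

lemma cauchy_green_spd:
  assumes "jac U X \<noteq> 0"
  shows "cauchy_green U X \<in> spd_tensors"
proof -
  have "0 < v \<bullet> (cauchy_green U X *v v)" if "v \<noteq> 0" for v
  proof -
    let ?F = "def_grad U X"
    have "v \<bullet> (cauchy_green U X *v v) = (?F *v v) \<bullet> (?F *v v)"
      unfolding cauchy_green_def
      by (metis dot_lmul_matrix matrix_vector_mul_assoc transpose_matrix_vector transpose_transpose)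
    moreover have "?F *v v \<noteq> 0"
      using assms that unfolding jac_def
      by (metis invertible_det_nz invertible_def matrix_vector_mul_assoc matrix_vector_mul_lid matrix_vector_mult_0_right)
    ultimately show ?thesis by simp
  qed
  then show ?thesis
    by (auto simp: spd_tensors_def symmetric_tensors_def cauchy_green_def matrix_transpose_mul)
qed

lemma spd_scaleR: "C \<in> spd_tensors \<Longrightarrow> 0 < c \<Longrightarrow> c *\<^sub>R C \<in> spd_tensors"
  by (auto simp: spd_tensors_def symmetric_tensors_def transpose_scalar scaleR_matrix_vector_assoc[symmetric])

lemma spd_add: "C \<in> spd_tensors \<Longrightarrow> D \<in> spd_tensors \<Longrightarrow> C + D \<in> spd_tensors"
  by (auto simp: spd_tensors_def symmetric_tensors_def transpose_add matrix_vector_mult_add_rdistrib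
      inner_add_right add_pos_pos)

text \<open>The Riesz representative of the derivative may be symmetrised without changing it on
  symmetric increments.\<close>

lemma tensor_derivative_symmetric:
  assumes "f differentiable (at C within symmetric_tensors)" "C \<in> symmetric_tensors"
  shows "tensor_derivative f C \<in> symmetric_tensors"
proof -
  obtain f' where f': "(f has_derivative f') (at C within symmetric_tensors)"
    using assms(1) by (auto simp: differentiable_def)
  then have lin: "bounded_linear f'"
    by (rule has_derivative_bounded_linear)
  define R where "R = (\<Sum>i\<in>Basis. f' i *\<^sub>R i)"
  have R: "f' H = R \<bullet> H" for H
  proof -
    have "f' H = f' (\<Sum>i\<in>Basis. (H \<bullet> i) *\<^sub>R i)"
      by (simp add: euclidean_representation)
    also have "\<dots> = (\<Sum>i\<in>Basis. (H \<bullet> i) * f' i)"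
      by (simp add: linear_sum[OF bounded_linear.linear[OF lin]] linear_scale[OF bounded_linear.linear[OF lin]])
    also have "\<dots> = R \<bullet> H"
      by (simp add: R_def inner_sum_left inner_commute[of H] mult.commute)
    finally show ?thesis .
  qed
  define A where "A = (1/2) *\<^sub>R (R + transpose R)"
  have A: "A \<in> symmetric_tensors"
    by (simp add: A_def symmetric_tensors_def transpose_scalar transpose_add add.commute)
  have agree: "A \<bullet> H = f' H" if "H \<in> symmetric_tensors" for H
    using symmetric_contract_transpose[OF that, of R] by (simp add: A_def R inner_add_left)
  \<comment> \<open>Increments within the subspace of symmetric tensors are symmetric, and there
    \<open>A\<close> and \<open>f'\<close> agree.\<close>
  have "(f has_derivative (\<lambda>H. A \<bullet> H)) (at C within symmetric_tensors)"
    unfolding has_derivative_within_alt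
  proof (intro conjI allI impI bounded_linear_inner_right)
    fix e :: real assume "0 < e"
    then obtain d where "0 < d" and d: "\<forall>y\<in>symmetric_tensors. norm (y - C) < d \<longrightarrow>
        norm (f y - f C - f' (y - C)) \<le> e * norm (y - C)"
      using f' unfolding has_derivative_within_alt by blast
    then show "\<exists>d>0. \<forall>y\<in>symmetric_tensors. norm (y - C) < d \<longrightarrow>
        norm (f y - f C - A \<bullet> (y - C)) \<le> e * norm (y - C)"
      using agree subspace_diff[OF subspace_symmetric_tensors _ assms(2)] by (intro exI[of _ d]) auto
  qed
  \<comment> \<open>Existence of one symmetric representative makes the value chosen by
    \<open>SOME\<close> symmetric.\<close>
  with A show ?thesis
    unfolding tensor_derivative_def by (metis (mono_tags, lifting) someI_ex)
qed

text \<open>This exhibits \<open>S_ich\<close> as a combination of the energy derivative and the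
  inverse of \<open>C\<close>, from which its symmetry can be read off.\<close>

lemma contract4_projection4:
  "contract4 (projection4 C) A = A - ((1/3) * (C \<bullet> A)) *\<^sub>R matrix_inv C"
proof -
  have "(identity4 $ i $ j) \<bullet> A = A $ i $ j" for i j
  proof -
    have "(identity4 $ i $ j) \<bullet> A =
        (\<Sum>k\<in>UNIV. if i = k then \<Sum>l\<in>UNIV. (if j = l then A $ k $ l else 0) else 0)"
      unfolding inner_matrix
    proof (rule sum.cong[OF refl])
      fix k show "(\<Sum>l\<in>UNIV. identity4 $ i $ j $ k $ l * A $ k $ l) =
          (if i = k then \<Sum>l\<in>UNIV. (if j = l then A $ k $ l else 0) else 0)"
        by (cases "i = k") (simp_all add: identity4_def mult_delta_left)
    qed
    then show ?thesis by simp
  qed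
  moreover have "(dyadic (matrix_inv C) C $ i $ j) \<bullet> A = matrix_inv C $ i $ j * (C \<bullet> A)" for i j
    unfolding inner_matrix dyadic_def by (simp add: sum_distrib_left mult.assoc)
  ultimately show ?thesis
    by (simp add: vec_eq_iff contract4_def projection4_def inner_diff_left)
qed

lemma S_ich_symmetric:
  assumes "C \<in> spd_tensors" "0 < J"
    and "\<And>C. C \<in> spd_tensors \<Longrightarrow> Gich differentiable (at C within symmetric_tensors)"
  shows "S_ich Gich J C \<in> symmetric_tensors"
proof -
  have spd: "J powr (-2/3) *\<^sub>R C \<in> spd_tensors"
    using assms(1,2) by (intro spd_scaleR) auto
  have "tensor_derivative Gich (J powr (-2/3) *\<^sub>R C) \<in> symmetric_tensors"
    using spd assms(3) by (intro tensor_derivative_symmetric) (auto simp: spd_tensors_def)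
  moreover have "matrix_inv C \<in> symmetric_tensors"
    using assms(1) by (intro symmetric_tensors_matrix_inv spd_invertible) (auto simp: spd_tensors_def)
  ultimately show ?thesis
    unfolding S_ich_def contract4_projection4
    by (intro subspace_mul subspace_diff subspace_symmetric_tensors)
qed

text \<open>
  With \<open>F\<^sub>m = (F\<^sub>0 + F\<^sub>1) / 2\<close>, the product \<open>F\<^sub>m\<^sup>T (F\<^sub>1 - F\<^sub>0)\<close> differs from
  \<open>(C\<^sub>1 - C\<^sub>0) / 2\<close> by the skew part of \<open>F\<^sub>0\<^sup>T F\<^sub>1\<close>.
\<close>

lemma midpoint_power_identity:
  fixes F0 F1 :: tensor2
  assumes "S \<in> symmetric_tensors"
  shows "(transpose ((1/2) *\<^sub>R (F0 + F1)) ** (F1 - F0)) \<bullet> S =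
    ((1/2) *\<^sub>R (transpose F1 ** F1 - transpose F0 ** F0)) \<bullet> S"
proof -
  have "(transpose F1 ** F0) \<bullet> S = (transpose F0 ** F1) \<bullet> S"
    using symmetric_contract_transpose[OF assms, of "transpose F1 ** F0"]
    by (simp add: matrix_transpose_mul)
  moreover have "transpose ((1/2) *\<^sub>R (F0 + F1)) ** (F1 - F0) =
      (1/2) *\<^sub>R ((transpose F1 ** F1 - transpose F0 ** F0) + (transpose F0 ** F1 - transpose F1 ** F0))"
    by (simp add: vec_eq_iff matrix_matrix_mult_def transpose_def sum_3 field_simps)
  ultimately show ?thesis
    by (simp add: inner_add_left inner_diff_left)
qed

section \<open>Gradients of the mid-point and increment fields\<close>

lemma jacobian_eqI:
  fixes f :: "real^'n \<Rightarrow> real^'m"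
  assumes "(f has_derivative (\<lambda>h. A *v h)) (at X)"
  shows "jacobian f (at X) = A"
  unfolding jacobian_def frechet_derivative_at[OF assms, symmetric]
  by simp

text \<open>Differentiation is linear and the two identity tensors average to the identity. Where a
  field is not differentiable, \<open>grad\<close> is an arbitrary chosen value, hence the pointwise
  hypotheses.\<close>

lemma def_grad_midpoint:
  assumes "U0 differentiable (at X)" "U1 differentiable (at X)"
  shows "def_grad (midpoint_field U0 U1) X = (1/2) *\<^sub>R (def_grad U0 X + def_grad U1 X)"
proof -
  have "((\<lambda>X. (1/2) *\<^sub>R (U0 X + U1 X)) has_derivative
      (\<lambda>h. (1/2) *\<^sub>R (grad U0 X *v h + grad U1 X *v h))) (at X)"
    using assms unfolding jacobian_works
    by (intro has_derivative_scaleR_right has_derivative_add)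
  then have "(midpoint_field U0 U1 has_derivative
      (\<lambda>h. ((1/2) *\<^sub>R (grad U0 X + grad U1 X)) *v h)) (at X)"
    unfolding midpoint_field_def[abs_def]
    by (simp only: matrix_vector_mult_add_rdistrib scaleR_matrix_vector_assoc[symmetric])
  then have "grad (midpoint_field U0 U1) X = (1/2) *\<^sub>R (grad U0 X + grad U1 X)"
    by (rule jacobian_eqI)
  then show ?thesis
    by (simp add: def_grad_def vec_eq_iff)
qed

text \<open>The kinematic equation holds on an open set, so it can be differentiated at
  \<open>X\<close>; differentiability of \<open>Vm\<close> is a result of this. The identity tensors
  cancel in the difference.\<close>

lemma grad_of_increment:
  assumes "open \<Omega>" "X \<in> \<Omega>" "kinematic_equation \<Omega> \<Delta>t U0 U1 Vm"
    and "U0 differentiable (at X)" "U1 differentiable (at X)"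
  shows "grad Vm X = (1/\<Delta>t) *\<^sub>R (def_grad U1 X - def_grad U0 X)"
proof -
  have "((\<lambda>X. (1/\<Delta>t) *\<^sub>R (U1 X - U0 X)) has_derivative
      (\<lambda>h. (1/\<Delta>t) *\<^sub>R (grad U1 X *v h - grad U0 X *v h))) (at X)"
    using assms(4,5) unfolding jacobian_works
    by (intro has_derivative_scaleR_right has_derivative_diff)
  then have "(Vm has_derivative (\<lambda>h. (1/\<Delta>t) *\<^sub>R (grad U1 X *v h - grad U0 X *v h))) (at X)"
    by (rule has_derivative_transform_within_open[OF _ assms(1,2)])
      (use assms(3) in \<open>simp add: kinematic_equation_def divide_inverse\<close>)
  then have "(Vm has_derivative (\<lambda>h. ((1/\<Delta>t) *\<^sub>R (grad U1 X - grad U0 X)) *v h)) (at X)"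
    by (simp only: matrix_vector_mult_diff_rdistrib scaleR_matrix_vector_assoc[symmetric])
  then have "grad Vm X = (1/\<Delta>t) *\<^sub>R (grad U1 X - grad U0 X)"
    by (rule jacobian_eqI)
  then show ?thesis
    by (simp add: def_grad_def)
qed

text \<open>Brings the stress power into the form to which directionality applies:
  \<open>1/\<Delta>t\<close> comes from the gradient of \<open>Vm\<close>, and the rest is
  \<open>midpoint_power_identity\<close>.\<close>

lemma discrete_stress_power:
  assumes "open \<Omega>" "X \<in> \<Omega>" "kinematic_equation \<Omega> \<Delta>t U0 U1 Vm"
    and "U0 differentiable (at X)" "U1 differentiable (at X)" "S \<in> symmetric_tensors"
  shows "(transpose (def_grad (midpoint_field U0 U1) X) ** grad Vm X) \<bullet> S =
    1/\<Delta>t * (S \<bullet> cauchy_green_increment U0 U1 X)"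
proof -
  have "(transpose (def_grad (midpoint_field U0 U1) X) ** grad Vm X) \<bullet> S =
      1/\<Delta>t * ((transpose ((1/2) *\<^sub>R (def_grad U0 X + def_grad U1 X)) ** (def_grad U1 X - def_grad U0 X)) \<bullet> S)"
    unfolding def_grad_midpoint[OF assms(4,5)] grad_of_increment[OF assms(1-5)] matrix_scalar_ac
      scalar_matrix_assoc[symmetric]
    by simp
  then show ?thesis
    unfolding midpoint_power_identity[OF assms(6)]
    by (simp add: cauchy_green_increment_def cauchy_green_def inner_commute)
qed

text \<open>The averaged tensor is positive definite as a mean of two Cauchy--Green tensors,
  although it is in general not one of the mid-point displacement.\<close>

lemma S_alg_symmetric:
  assumes "\<And>C. C \<in> spd_tensors \<Longrightarrow> Gich differentiable (at C within symmetric_tensors)"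
    and "S_enh X \<in> symmetric_tensors"
    and "jac U0 X \<noteq> 0" "jac U1 X \<noteq> 0" "0 < jac (midpoint_field U0 U1) X"
  shows "S_alg Gich S_enh U0 U1 X \<in> symmetric_tensors"
proof -
  have "cauchy_green_mid U0 U1 X \<in> spd_tensors"
    unfolding cauchy_green_mid_def using assms(3,4)
    by (intro spd_scaleR spd_add cauchy_green_spd) auto
  then show ?thesis
    unfolding S_alg_def using assms
    by (intro subspace_add[OF subspace_symmetric_tensors] S_ich_symmetric) auto
qed

section \<open>The energy balance\<close>

text \<open>Difference of squares: the mid-point average times the increment is exactly half the
  increment of the squared norm.\<close>

lemma kinetic_energy_increment:
  "midpoint_field V0 V1 X \<bullet> (\<rho> *\<^sub>R ((V1 X - V0 X) /\<^sub>R \<Delta>t)) =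
    1/\<Delta>t * (1/2 * \<rho> * (norm (V1 X))\<^sup>2 - 1/2 * \<rho> * (norm (V0 X))\<^sup>2)"
proof -
  have square: "(V0 X + V1 X) \<bullet> (V1 X - V0 X) = (norm (V1 X))\<^sup>2 - (norm (V0 X))\<^sup>2"
    by (simp add: power2_norm_eq_inner inner_add_left inner_diff_right inner_commute[of "V1 X" "V0 X"])
  have "midpoint_field V0 V1 X \<bullet> (\<rho> *\<^sub>R ((V1 X - V0 X) /\<^sub>R \<Delta>t)) =
      (1/2) * (\<rho> * (inverse \<Delta>t * ((norm (V1 X))\<^sup>2 - (norm (V0 X))\<^sup>2)))"
    by (simp only: midpoint_field_def inner_scaleR_left inner_scaleR_right square)
  also have "\<dots> = 1/\<Delta>t * (1/2 * \<rho> * (norm (V1 X))\<^sup>2 - 1/2 * \<rho> * (norm (V0 X))\<^sup>2)"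
    by (simp only: divide_inverse right_diff_distrib mult_1_left mult.left_commute mult.commute mult.assoc)
  finally show ?thesis .
qed

text \<open>Lebesgue measure is complete, so \<open>g\<close> inherits measurability from
  \<open>f\<close> through equality almost everywhere.\<close>

lemma set_lebesgue_integral_lebesgue_cong_AE:
  fixes f g :: "'a::euclidean_space \<Rightarrow> 'b::euclidean_space"
  assumes "set_integrable lebesgue S f" "AE x in lebesgue. x \<in> S \<longrightarrow> f x = g x"
  shows "(LINT x:S|lebesgue. f x) = (LINT x:S|lebesgue. g x)"
proof -
  have "(\<lambda>x. indicator S x *\<^sub>R f x) \<in> borel_measurable lebesgue"
    using assms(1) by (auto simp: set_integrable_def)
  moreover have AE: "AE x in lebesgue. indicator S x *\<^sub>R f x = indicator S x *\<^sub>R g x"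
    using assms(2) by eventually_elim (auto simp: indicator_def)
  ultimately show ?thesis
    unfolding set_lebesgue_integral_def by (intro integral_cong_AE) (auto intro: borel_measurable_AE)
qed

text \<open>Time independence of the boundary data enters here: prescribed velocities are zero on
  \<open>\<Gamma>G\<close>, and so is their mean.\<close>

lemma midpoint_test_velocity:
  assumes "\<And>X s t. X \<in> \<Gamma>G \<Longrightarrow> G X s = G X t"
    and "V0 \<in> trial_velocities S \<Gamma>G G t0" "V1 \<in> trial_velocities S \<Gamma>G G t1"
    and "midpoint_field V0 V1 \<in> S"
  shows "midpoint_field V0 V1 \<in> test_velocities S \<Gamma>G"
proof -
  have "vector_derivative (G X) (at t) = 0" if "X \<in> \<Gamma>G" for X t
  proof -
    have "G X = (\<lambda>_. G X t)"
      using assms(1)[OF that] by blast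
    then show ?thesis
      by (metis vector_derivative_const_at)
  qed
  then show ?thesis
    using assms(2-4) by (auto simp: trial_velocities_def test_velocities_def midpoint_field_def)
qed

text \<open>The hypothesis \<open>orientation\<close> serves twice, for the symmetry of the
  algorithmic stress and for the sign of the dissipation; \<open>energies\<close> makes the
  integrals in the two total energies genuine.\<close>

theorem proposition1:
  fixes \<Omega> \<Gamma>G \<Gamma>H :: "vec3 set" and \<psi> :: "vec3 \<Rightarrow> vec3"
    and p a b :: nat and Z :: "3 \<Rightarrow> real list" and r :: "3 \<Rightarrow> int list"
    and wS wP :: "(3 \<Rightarrow> nat) \<Rightarrow> real"
    and \<rho>0 :: "vec3 \<Rightarrow> real" and \<gamma> t0 t1 \<Delta>t tm :: real
    and B H G :: "vec3 \<Rightarrow> real \<Rightarrow> vec3"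
    and Gich :: "tensor2 \<Rightarrow> real" and S_enh :: "vec3 \<Rightarrow> tensor2"
    and U0 U1 V0 V1 Um Vm :: "vec3 \<Rightarrow> vec3" and P0 P1 Pm :: "vec3 \<Rightarrow> real"
    and Sh :: "(vec3 \<Rightarrow> vec3) set" and Ph :: "(vec3 \<Rightarrow> real) set"
  defines "Sh \<equiv> push_forward \<psi> (S_hat p a b Z r wS)"
    and "Ph \<equiv> push_forward \<psi> (P_hat p Z r wP)"
    and "\<Delta>t \<equiv> t1 - t0" and "tm \<equiv> (t0 + t1) / 2"
    and "Um \<equiv> midpoint_field U0 U1" and "Pm \<equiv> midpoint_field P0 P1"
    and "Vm \<equiv> midpoint_field V0 V1"
  assumes domain: "bounded \<Omega>" "open \<Omega>" "lipschitz_boundary \<Omega>"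
    and boundary_parts: "\<Gamma>G \<in> sets borel" "\<Gamma>H \<in> sets borel" "frontier \<Omega> = \<Gamma>G \<union> \<Gamma>H"
      "\<Gamma>G \<inter> \<Gamma>H \<in> null_sets surface_measure"
    and map: "geometrical_map \<Omega> \<psi>"
    and degrees: "1 \<le> a" "b < a"
    and mesh: "\<And>d. valid_mesh p (Z d) (r d)"
    and weights: "positive_weights (\<lambda>_. p + a) Z (raise_regularity b r) wS"
      "positive_weights (\<lambda>_. p) Z r wP"
    and gamma: "0 \<le> \<gamma>"
    and free_energy: "\<And>C. C \<in> spd_tensors \<Longrightarrow> Gich differentiable (at C within symmetric_tensors)"
    and enhancement: "\<And>X. X \<in> \<Omega> \<Longrightarrow> S_enh X \<in> symmetric_tensors"
    and time_step: "t0 < t1"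
    and state0: "U0 \<in> trial_displacements Sh \<Gamma>G G t0" "P0 \<in> Ph" "V0 \<in> trial_velocities Sh \<Gamma>G G t0"
    and state1: "U1 \<in> trial_displacements Sh \<Gamma>G G t1" "P1 \<in> Ph" "V1 \<in> trial_velocities Sh \<Gamma>G G t1"
    and orientation: "AE X in lebesgue. X \<in> \<Omega> \<longrightarrow> 0 < jac U0 X \<and> 0 < jac U1 X \<and> 0 < jac Um X"
    and kinematic: "kinematic_equation \<Omega> \<Delta>t U0 U1 Vm"
    and mass: "\<And>Q. Q \<in> Ph \<Longrightarrow> mass_equation \<Omega> Um Vm Q"
    and momentum: "\<And>W. W \<in> test_velocities Sh \<Gamma>G \<Longrightarrow>
      momentum_equation \<Omega> \<Gamma>H \<rho>0 \<gamma> (\<lambda>X. B X tm) (\<lambda>X. H X tm)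
        (S_alg Gich S_enh U0 U1) \<Delta>t Um Pm V0 V1 W"
    and energies: "set_integrable lebesgue \<Omega> (energy_density \<rho>0 Gich U0 V0)"
      "set_integrable lebesgue \<Omega> (energy_density \<rho>0 Gich U1 V1)"
    and time_independent: "\<And>X s t. X \<in> \<Gamma>G \<Longrightarrow> G X s = G X t"
    and directionality: "AE X in lebesgue. X \<in> \<Omega> \<longrightarrow>
      S_alg Gich S_enh U0 U1 X \<bullet> cauchy_green_increment U0 U1 X =
      Gich (modified_cauchy_green U1 X) - Gich (modified_cauchy_green U0 X)"
  shows "1 / \<Delta>t * (total_energy \<Omega> \<rho>0 Gich U1 V1 - total_energy \<Omega> \<rho>0 Gich U0 V0) =
           (LINT X:\<Omega>|lebesgue. \<rho>0 X * (Vm X \<bullet> B X tm))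
           + (LINT X:\<Gamma>H|surface_measure. Vm X \<bullet> H X tm)
           - dissipation \<Omega> \<gamma> Um Vm
         \<and> 0 \<le> dissipation \<Omega> \<gamma> Um Vm"
proof -
  have "Vm \<in> Sh"
    using state0(3) state1(3) unfolding Vm_def Sh_def trial_velocities_def
    by (auto intro: push_forward_midpoint S_hat_midpoint)
  then have "Vm \<in> test_velocities Sh \<Gamma>G"
    unfolding Vm_def using midpoint_test_velocity[OF time_independent state0(3) state1(3)] by blast
  \<comment> \<open>The test function is \<open>W = Vm\<close>.\<close>
  note momentum_Vm = momentum[OF this, unfolded momentum_equation_def, folded Vm_def]
  have "Pm \<in> Ph"
    using state0(2) state1(2) unfolding Pm_def Ph_def
    by (auto intro: push_forward_midpoint P_hat_midpoint)
  note mass_Pm = mass[OF this, unfolded mass_equation_def]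

  let ?e0 = "energy_density \<rho>0 Gich U0 V0" and ?e1 = "energy_density \<rho>0 Gich U1 V1"
    and ?mass = "mass_integrand Um Vm Pm"
    and ?mom = "momentum_integrand \<rho>0 (\<lambda>X. B X tm) (S_alg Gich S_enh U0 U1) \<Delta>t Um Pm V0 V1 Vm"
  have "U0 \<in> Sh" "U1 \<in> Sh"
    using state0(1) state1(1) by (auto simp: trial_displacements_def)
  note differentiable =
    this[unfolded Sh_def, THEN push_forward_S_hat_differentiable[OF map domain(2) mesh weights(1)]]
  \<comment> \<open>The pressure terms of \<open>?mass\<close> and \<open>?mom\<close> cancel.
    Solving for the body-force power leaves only integrands known to be integrable on the left, so
    integrability carries over to the right.\<close>
  have density: "AE X in lebesgue. X \<in> \<Omega> \<longrightarrow>
      1/\<Delta>t * (?e1 X - ?e0 X) - ?mass X - ?mom X = \<rho>0 X * (Vm X \<bullet> B X tm)"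
    using differentiable orientation directionality
  proof (eventually_elim, intro impI)
    fix X
    assume elim: "X \<in> \<Omega> \<longrightarrow> U0 differentiable (at X)" "X \<in> \<Omega> \<longrightarrow> U1 differentiable (at X)"
      "X \<in> \<Omega> \<longrightarrow> 0 < jac U0 X \<and> 0 < jac U1 X \<and> 0 < jac Um X"
      "X \<in> \<Omega> \<longrightarrow> S_alg Gich S_enh U0 U1 X \<bullet> cauchy_green_increment U0 U1 X =
        Gich (modified_cauchy_green U1 X) - Gich (modified_cauchy_green U0 X)"
      and X: "X \<in> \<Omega>"
    have "S_alg Gich S_enh U0 U1 X \<in> symmetric_tensors"
      using elim X enhancement[of X] unfolding Um_def by (intro S_alg_symmetric free_energy) auto
    then have "(transpose (def_grad Um X) ** grad Vm X) \<bullet> S_alg Gich S_enh U0 U1 X =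
        1/\<Delta>t * (Gich (modified_cauchy_green U1 X) - Gich (modified_cauchy_green U0 X))"
      using elim X discrete_stress_power[OF domain(2) X kinematic] unfolding Um_def by simp
    moreover have "Vm X \<bullet> (\<rho>0 X *\<^sub>R ((V1 X - V0 X) /\<^sub>R \<Delta>t)) =
        1/\<Delta>t * (1/2 * \<rho>0 X * (norm (V1 X))\<^sup>2 - 1/2 * \<rho>0 X * (norm (V0 X))\<^sup>2)"
      unfolding Vm_def by (rule kinetic_energy_increment)
    ultimately show "1/\<Delta>t * (?e1 X - ?e0 X) - ?mass X - ?mom X = \<rho>0 X * (Vm X \<bullet> B X tm)"
      unfolding momentum_integrand_def mass_integrand_def energy_density_def
      by (simp only: inner_scaleR_right) (simp add: algebra_simps)
  qed
  have integrable: "set_integrable lebesgue \<Omega> (\<lambda>X. 1/\<Delta>t * (?e1 X - ?e0 X))"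
      "set_integrable lebesgue \<Omega> (\<lambda>X. 1/\<Delta>t * (?e1 X - ?e0 X) - ?mass X)"
      "set_integrable lebesgue \<Omega> (\<lambda>X. 1/\<Delta>t * (?e1 X - ?e0 X) - ?mass X - ?mom X)"
    using energies momentum_Vm mass_Pm
    by (auto intro!: set_integral_diff set_integrable_mult_right)
  have "(LINT X:\<Omega>|lebesgue. \<rho>0 X * (Vm X \<bullet> B X tm)) =
      (LINT X:\<Omega>|lebesgue. 1/\<Delta>t * (?e1 X - ?e0 X) - ?mass X - ?mom X)"
    using set_lebesgue_integral_lebesgue_cong_AE[OF integrable(3) density] by simp
  \<comment> \<open>The integral of \<open>?mass\<close> is zero by the mass equation tested with
    \<open>Pm\<close>.\<close>
  also have "\<dots> = 1/\<Delta>t * ((LINT X:\<Omega>|lebesgue. ?e1 X) - (LINT X:\<Omega>|lebesgue. ?e0 X))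
      - (LINT X:\<Omega>|lebesgue. ?mom X)"
    using integrable energies momentum_Vm mass_Pm by (simp add: set_integral_diff)
  finally have power: "(LINT X:\<Omega>|lebesgue. \<rho>0 X * (Vm X \<bullet> B X tm)) =
      1/\<Delta>t * (total_energy \<Omega> \<rho>0 Gich U1 V1 - total_energy \<Omega> \<rho>0 Gich U0 V0)
      - (LINT X:\<Omega>|lebesgue. ?mom X)"
    by (simp add: total_energy_def)
  \<comment> \<open>With \<open>W = Vm\<close> the two divergence factors coincide and form a
    square.\<close>
  have "graddiv_integrand \<gamma> Um Vm Vm =
      (\<lambda>X. \<gamma> * jac Um X * (grad Vm X \<bullet> inv_transpose (def_grad Um X))\<^sup>2)"
    by (simp add: graddiv_integrand_def fun_eq_iff power2_eq_square mult.assoc)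
  then have dissipation: "(LINT X:\<Omega>|lebesgue. graddiv_integrand \<gamma> Um Vm Vm X) = dissipation \<Omega> \<gamma> Um Vm"
    by (simp add: dissipation_def)
  have "AE X in lebesgue. 0 \<le> indicator \<Omega> X *\<^sub>R
      (\<gamma> * jac Um X * (grad Vm X \<bullet> inv_transpose (def_grad Um X))\<^sup>2)"
    using orientation by eventually_elim (use gamma in \<open>auto simp: indicator_def\<close>)
  then have "0 \<le> dissipation \<Omega> \<gamma> Um Vm"
    unfolding dissipation_def set_lebesgue_integral_def by (rule integral_nonneg_AE)
  \<comment> \<open>The momentum equation turns the integral of \<open>?mom\<close> into the
    traction power minus the dissipation.\<close>
  with momentum_Vm power dissipation show ?thesis
    by simp
qed

end
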